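(* $\frac{9-3\sqrt{5}}{4}\le a_{3,2}$.
   Context: Let $H_{n,3}=\{0,1,\dots,n-1\}^3$. A $2$-rook is a point $P\in H_{n,3}$ together with a set $D$ of $2$ of the $3$ coordinate indices; it covers $P$ itself and every point of $H_{n,3}$ which differs from $P$ in exactly one coordinate, that coordinate belonging to $D$. Distinct rooks must occupy distinct points. $a_{n,3,2}$ is the minimum number of $2$-rooks whose covered sets together cover $H_{n,3}$, and $a_{3,2}=\lim_{n\to\infty} a_{n,3,2}/n^{2}$ (this limit exists). *)

theory Defs
  imports Complex_Main "HOL-Library.Numeral_Type"
begin

text \<open>The type \<open>3\<close> has exactly three elements; it serves as the set of coordinate indices.\<close>

definition cube :: "nat \<Rightarrow> (3 \<Rightarrow> nat) set" where
  "cube n = {P. \<forall>i. P i < n}"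

definition rooks :: "nat \<Rightarrow> ((3 \<Rightarrow> nat) \<times> 3 set) set" where
  "rooks n = {(P, D). P \<in> cube n \<and> card D = 2}"

definition covered :: "nat \<Rightarrow> (3 \<Rightarrow> nat) \<times> 3 set \<Rightarrow> (3 \<Rightarrow> nat) set" where
  "covered n = (\<lambda>(P, D). {Q \<in> cube n. Q = P \<or> (\<exists>i\<in>D. {j. Q j \<noteq> P j} = {i})})"

text \<open>Injectivity of \<^const>\<open>fst\<close> says that distinct rooks occupy distinct points.\<close>

definition rook_covering :: "nat \<Rightarrow> ((3 \<Rightarrow> nat) \<times> 3 set) set \<Rightarrow> bool" where
  "rook_covering n R \<longleftrightarrow>
     R \<subseteq> rooks n \<and> inj_on fst R \<and> cube n \<subseteq> (\<Union>r\<in>R. covered n r)"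

text \<open>The minimum is attained: placing a rook on every point gives a covering, and every
  covering is finite because \<^term>\<open>rooks n\<close> is.\<close>

definition min_rooks :: "nat \<Rightarrow> nat" where
  "min_rooks n = (LEAST m. \<exists>R. rook_covering n R \<and> card R = m)"

definition rook_density :: real where
  "rook_density = lim (\<lambda>n. real (min_rooks n) / real n ^ 2)"

end

theory Submission
  imports Defs "HOL-Library.FuncSet"
begin

text \<open>A covering of the cube amounts to three families of covered axis-parallel lines such that every
  point lies on one of them. With all counts normalised by the side length \<open>n\<close>, let \<open>R\<close> be the
  density of rooks: the line densities add up to at most \<open>2 R\<close>, and, since a rook covers at most one
  line of each direction inside a layer, the average over parallel layers of the larger of the two
  line densities in a layer is at most \<open>R\<close>. Take a layer minimising (larger density) \<open>+ 2/3 \<cdot>\<close>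
  (smaller density) over the layers of all three directions. Its points on no covered line of the layer
  form a rectangle \<open>U \<times> V\<close>, all of whose perpendicular lines must be covered. Counting rooks in
  the layers over \<open>U\<close> and over the complement of \<open>U\<close> (similarly for \<open>V\<close>), together
  with the volume of the blocks \<open>U \<times> V\<^sup>c\<close> and \<open>U\<^sup>c \<times> V\<close>, gives linear
  inequalities which are incompatible with \<open>R < 0.573\<close>. The limit exists because replacing each
  point by an \<open>m \<times> m \<times> m\<close> block with a Latin square of rooks shows
  \<open>a\<^sub>m\<^sub>k \<le> m\<^sup>2 a\<^sub>k\<close>, while enlarging the cube by one costs only \<open>O(n)\<close> rooks.\<close>

section \<open>The final inequalities\<close>

text \<open>For \<open>q\<close> at most 1/4 the bound \<open>C1\<close> of
  \<open>rook_density_inequality\<close> is contradictory by itself. The right side decreases in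
  \<open>p\<close> on this range, so the extreme case is
  \<open>3 * p + 2 * q = 2101/1000\<close>.\<close>

lemma weighted_layer_bound_small:
  fixes p q :: real
  assumes "0 \<le> q" "q \<le> 1/4" "3 * p + 2 * q \<le> 2101/1000"
  shows "573/1000 \<le> (1-p)*(1-q) + p * ((3 * p + 2 * q)/5)"
proof -
  define P where "P = (2101/1000 - 2*q)/3"
  have le: "p \<le> P" using assms by (simp add: P_def)
  have "(1-p)*(1-q) + p * ((3 * p + 2 * q)/5) - ((1-P)*(1-q) + P * ((3 * P + 2 * q)/5))
      = (P - p) * (1 - 7/5*q - 3/5*(p+P))" by (simp add: field_simps)
  moreover have "0 \<le> 1 - 7/5*q - 3/5*(p+P)" using assms by (simp add: P_def field_simps)
  ultimately have 1: "(1-P)*(1-q) + P * ((3 * P + 2 * q)/5) \<le> (1-p)*(1-q) + p * ((3 * p + 2 * q)/5)"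
    using le mult_nonneg_nonneg[of "P-p" "1 - 7/5*q - 3/5*(p+P)"] by linarith
  \<comment> \<open>Both sides have \<open>q^2\<close> coefficient -2/3, so their difference is
    linear in \<open>q\<close>.\<close>
  have "573/1000 + 2/3 * (q * (1/4 - q)) \<le> (1-P)*(1-q) + P * ((3 * P + 2 * q)/5)"
    using assms(1,2) by (simp add: P_def field_simps)
  moreover have "0 \<le> q * (1/4 - q)" using assms by simp
  ultimately show ?thesis using 1 by linarith
qed

text \<open>Closes the case \<open>q > 1/4\<close> of \<open>rook_density_inequality\<close>. With
  \<open>d = p - q\<close> one has \<open>t = s/2 + d/10\<close>; discarding the nonnegative
  contribution of \<open>d/10\<close> leaves only even powers of \<open>d\<close>.\<close>

lemma weighted_layer_bound_large:
  fixes p q :: real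
  assumes "1/4 \<le> q" "q \<le> p" "3 * p + 2 * q \<le> 2101/1000"
  defines "s \<equiv> p + q" and "m \<equiv> p * q" and "t \<equiv> (3 * p + 2 * q)/5"
  shows "573/1000 * s < s - s^2 + m + s*m - m^2 + t*((p-q)^2 + m*s)"
proof -
  define d where "d = p - q"
  \<comment> \<open>\<open>s * h\<close> is the part of the remaining difference that is free of
    \<open>d\<close>.\<close>
  define h where "h = 427/1000 - 3/4*s + s^2/4 + s^3/16"
  have d0: "0 \<le> d" and ds: "d \<le> s - 1/2" and sd: "s + d/5 \<le> 8404/10000"
    unfolding d_def s_def using assms(1-3) by argo+
  have m: "m = (s^2 - d^2)/4" by (simp add: m_def s_def d_def power2_eq_square field_simps)
  have t: "t = s/2 + d/10" by (simp add: t_def s_def d_def field_simps)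
  have "s - s^2 + m + s*m - m^2 + s/2*(d^2 + m*s) - 573/1000 * s
        = s * h - d^2 * (1/4 - s/4 + d^2/16)"
    unfolding m h_def by (simp add: power2_eq_square power3_eq_cube field_simps)
  moreover have "0 \<le> d/10*(d^2+m*s)" using assms d0 by (simp add: m_def s_def)
  hence "s/2*(d^2+m*s) \<le> t*((p-q)^2 + m*s)"
    unfolding t by (simp add: d_def field_simps)
  moreover have "d^2 * (1/4 - s/4 + d^2/16) < s * h"
  proof -
    have dd: "d \<le> 29/100" using ds sd by linarith
    have e0: "0 \<le> 8404/10000 - s" using d0 sd by linarith
    \<comment> \<open>\<open>h\<close> is expanded at the largest possible \<open>s\<close>, with
      coefficients rounded down. Since \<open>e\<close> is at least \<open>d/5\<close>, its slope in
      \<open>e\<close> becomes a gain in \<open>d\<close>.\<close>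
    define e where "e = 8404/10000 - s"
    have s: "s = 8404/10000 - e" by (simp add: e_def)
    have e: "0 \<le> e" "e \<le> 1" using e0 ds d0 by (simp_all add: e_def)
    have "0 \<le> e^2 * (4/10 - e/16)" using e by simp
    moreover have "e^2 * (4/10 - e/16) \<le> h - (103/10000 + 19/100*e)"
      unfolding h_def s using e by (simp add: power2_eq_square power3_eq_cube field_simps)
    ultimately have "0 \<le> h - (103/10000 + 19/100*e)" by linarith
    hence h: "h \<ge> 103/10000 + 38/1000 * d" using sd e_def by linarith
    \<comment> \<open>Replacing \<open>s\<close> by its lower bound \<open>1/2 + d\<close> leaves an
      inequality in \<open>d\<close> alone.\<close>
    have "d^2 * (1/4 - s/4 + d^2/16) \<le> d^2 * (1/4 - (1/2+d)/4 + d^2/16)"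
      using ds by (intro mult_left_mono) auto
    also have "\<dots> < (1/2+d) * (103/10000 + 38/1000 * d)"
    proof -
      have "0 \<le> d * (29/1000 - 87/1000 * d)" using d0 dd by simp
      moreover have "0 \<le> d^3 * (1/4 - d/16)" using d0 dd by simp
      ultimately show ?thesis
        using d0 by (simp add: power2_eq_square power3_eq_cube field_simps)
    qed
    also have "\<dots> \<le> s * h" using h ds d0 by (intro mult_mono) auto
    finally show ?thesis .
  qed
  ultimately show ?thesis by linarith
qed

text \<open>Here \<open>1 - q\<close> and \<open>1 - p\<close> are the densities of \<open>U\<close> and \<open>V\<close>; \<open>d1\<close> and \<open>d2\<close> are the
  densities of the perpendicular lines over \<open>U \<times> V\<^sup>c\<close> and \<open>U\<^sup>c \<times> V\<close>; the remaining lines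
  are counted by \<open>a\<close>, \<open>b\<close> (over \<open>U\<close>, \<open>U\<^sup>c\<close>) and \<open>a'\<close>, \<open>b'\<close> (over \<open>V\<close>, \<open>V\<^sup>c\<close>).\<close>

lemma rook_density_inequality:
  fixes p q \<tau> R :: real
  assumes q0: "0 \<le> q" and qp: "q \<le> p" and t: "3 * p + 2 * q = 5 * \<tau>" and tR: "15 * \<tau> \<le> 11 * R"
    and B1: "(1-p)*(1-q) + d1 + q * \<tau> \<le> R" and B2: "(1-p)*(1-q) + d1 + b \<le> R"
    and C1: "(1-p)*(1-q) + d2 + p * \<tau> \<le> R" and C2: "(1-p)*(1-q) + d2 + b' \<le> R"
    and V1: "p * (1-q) \<le> d1 + p * a + (1-q) * b'" and V2: "q * (1-p) \<le> d2 + q * a' + (1-p) * b"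
    and S: "(1-p)*(1-q) + d1 + d2 + a + a' + b + b' \<le> 2 * R"
    and d: "0 \<le> d1" "0 \<le> d2"
  shows "573/1000 \<le> R"
proof (rule ccontr)
  assume "\<not> ?thesis" hence R: "R < 573/1000" by simp
  \<comment> \<open>The constant is 11/3 times 573/1000.\<close>
  have pq: "3 * p + 2 * q \<le> 2101/1000" using t tR R by linarith
  have tau: "\<tau> = (3 * p + 2 * q)/5" using t by simp
  have q: "q > 1/4"
    using weighted_layer_bound_small[OF q0 _ pq] C1 R d unfolding tau by linarith
  define w where "w = 1-p-q"
  have w: "0 \<le> w" using qp pq by (simp add: w_def)
  \<comment> \<open>This becomes the multiplier of \<open>B1\<close> below. It is nonnegative for
    every \<open>p\<close> exactly when \<open>q\<close> is at least 1/4, whence the case split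
    there.\<close>
  have k1: "0 \<le> q - p + p^2"
  proof -
    have "q - p + p^2 = (q - 1/4) + (p - 1/2)^2" by (simp add: power2_eq_square field_simps)
    thus ?thesis using q zero_le_power2[of "p - 1/2"] by linarith
  qed
  have k2: "0 \<le> p - q + q^2" using qp by simp
  have p0: "0 < p" using q qp by simp
  \<comment> \<open>\<open>S\<close> scaled by \<open>p q\<close> absorbs \<open>V1\<close>, \<open>V2\<close>, \<open>B2\<close>, \<open>C2\<close>, \<open>B1\<close>, \<open>C1\<close> so that exactly
    \<open>a, a', b, b', d1, d2\<close> cancel.\<close>
  have "(p+q) * R - ((p+q) - (p+q)^2 + p*q + (p+q)*(p*q) - (p*q)^2 + \<tau>*((p-q)^2 + p*q*(p+q)))
    = p*q * (2*R - ((1-p)*(1-q) + d1 + d2 + a + a' + b + b'))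
      + q * (d1 + p*a + (1-q)*b' - p*(1-q)) + p * (d2 + q*a' + (1-p)*b - q*(1-p))
      + p*w * (R - ((1-p)*(1-q) + d1 + b)) + q*w * (R - ((1-p)*(1-q) + d2 + b'))
      + (q - p + p^2) * (R - ((1-p)*(1-q) + d1 + q*\<tau>))
      + (p - q + q^2) * (R - ((1-p)*(1-q) + d2 + p*\<tau>))"
    unfolding w_def by algebra
  moreover have "0 \<le> p*q * (2*R - ((1-p)*(1-q) + d1 + d2 + a + a' + b + b'))"
    using S p0 q by (intro mult_nonneg_nonneg) auto
  moreover have "0 \<le> q * (d1 + p*a + (1-q)*b' - p*(1-q))"
    using V1 q by (intro mult_nonneg_nonneg) auto
  moreover have "0 \<le> p * (d2 + q*a' + (1-p)*b - q*(1-p))"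
    using V2 p0 by (intro mult_nonneg_nonneg) auto
  moreover have "0 \<le> p*w * (R - ((1-p)*(1-q) + d1 + b))"
    using B2 p0 w by (intro mult_nonneg_nonneg) auto
  moreover have "0 \<le> q*w * (R - ((1-p)*(1-q) + d2 + b'))"
    using C2 q w by (intro mult_nonneg_nonneg) auto
  moreover have "0 \<le> (q - p + p^2) * (R - ((1-p)*(1-q) + d1 + q*\<tau>))"
    using B1 k1 by (intro mult_nonneg_nonneg) auto
  moreover have "0 \<le> (p - q + q^2) * (R - ((1-p)*(1-q) + d2 + p*\<tau>))"
    using C1 k2 by (intro mult_nonneg_nonneg) auto
  ultimately have "(p+q) - (p+q)^2 + p*q + (p+q)*(p*q) - (p*q)^2 + \<tau>*((p-q)^2 + p*q*(p+q))
      \<le> (p+q)*R"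
    by linarith
  also have "\<dots> \<le> (p+q)* (573/1000)" using R q qp by (intro mult_left_mono) auto
  finally show False using weighted_layer_bound_large[of q p] q qp pq unfolding tau by simp
qed

section \<open>Covering lines of the cube\<close>

definition avg :: "nat \<Rightarrow> (nat \<Rightarrow> real) \<Rightarrow> real" where
  "avg n f = (\<Sum>i<n. f i) / real n"

lemma avg_mono: "(\<And>i. i < n \<Longrightarrow> f i \<le> g i) \<Longrightarrow> avg n f \<le> avg n g"
  unfolding avg_def by (intro divide_right_mono sum_mono) auto

lemma avg_cong: "(\<And>i. i < n \<Longrightarrow> f i = g i) \<Longrightarrow> avg n f = avg n g"
  unfolding avg_def by simp

lemma avg_nonneg: "(\<And>i. i < n \<Longrightarrow> 0 \<le> f i) \<Longrightarrow> 0 \<le> avg n f"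
  unfolding avg_def by (intro divide_nonneg_nonneg sum_nonneg) auto

lemma avg_add: "avg n (\<lambda>i. f i + g i) = avg n f + avg n g"
  unfolding avg_def by (simp add: sum.distrib add_divide_distrib)

lemma avg_diff: "avg n (\<lambda>i. f i - g i) = avg n f - avg n g"
  unfolding avg_def by (simp add: sum_subtractf diff_divide_distrib)

lemma avg_mult_left: "avg n (\<lambda>i. c * f i) = c * avg n f"
  unfolding avg_def by (simp add: sum_distrib_left)

lemma avg_mult_right: "avg n (\<lambda>i. f i * c) = avg n f * c"
  unfolding avg_def by (simp add: sum_distrib_right)

lemma avg_const: "0 < n \<Longrightarrow> avg n (\<lambda>i. c) = c"
  unfolding avg_def by simp

lemma avg_swap: "avg n (\<lambda>i. avg n (\<lambda>j. f i j)) = avg n (\<lambda>j. avg n (\<lambda>i. f i j))"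
  unfolding avg_def sum_divide_distrib[symmetric] by (simp add: sum.swap[of f])

text \<open>Three times the weight is \<open>max s t + 2 * (s + t)\<close>, so its average is
  controlled by the bound on layers and the bound on lines together.\<close>

definition layer_weight :: "real \<Rightarrow> real \<Rightarrow> real" where
  "layer_weight s t = max s t + 2/3 * min s t"

lemma layer_weight_commute: "layer_weight s t = layer_weight t s"
  by (simp add: layer_weight_def max.commute min.commute)

text \<open>\<open>\<alpha> y z\<close>, \<open>\<beta> x z\<close>, \<open>\<gamma> x y\<close> indicate the covered lines in the first, second and third coordinate
  direction.\<close>

locale line_cover =
  fixes n :: nat and \<alpha> \<beta> \<gamma> :: "nat \<Rightarrow> nat \<Rightarrow> real" and R :: real
  assumes n_pos: "0 < n"
    and ind: "\<And>i j. \<alpha> i j \<in> {0, 1}" "\<And>i j. \<beta> i j \<in> {0, 1}" "\<And>i j. \<gamma> i j \<in> {0, 1}"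
    and cover: "\<And>x y z. x < n \<Longrightarrow> y < n \<Longrightarrow> z < n \<Longrightarrow> \<alpha> y z = 1 \<or> \<beta> x z = 1 \<or> \<gamma> x y = 1"
    and layers_x: "avg n (\<lambda>x. max (avg n (\<lambda>z. \<beta> x z)) (avg n (\<lambda>y. \<gamma> x y))) \<le> R"
    and layers_y: "avg n (\<lambda>y. max (avg n (\<lambda>z. \<alpha> y z)) (avg n (\<lambda>x. \<gamma> x y))) \<le> R"
    and layers_z: "avg n (\<lambda>z. max (avg n (\<lambda>y. \<alpha> y z)) (avg n (\<lambda>x. \<beta> x z))) \<le> R"
    and lines: "avg n (\<lambda>y. avg n (\<lambda>z. \<alpha> y z)) + avg n (\<lambda>x. avg n (\<lambda>z. \<beta> x z))
      + avg n (\<lambda>x. avg n (\<lambda>y. \<gamma> x y)) \<le> 2 * R"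
begin

lemma swap_xy: "line_cover n \<beta> \<alpha> (\<lambda>x y. \<gamma> y x) R"
  using n_pos ind layers_x layers_y layers_z lines avg_swap[of n \<gamma>]
  by unfold_locales
    ((use cover in blast) | (auto simp: max.commute add.commute add.left_commute))+

text \<open>A cyclic relabelling in which the old first coordinate becomes the third; it allows the
  minimal layer to be taken perpendicular to the third axis.\<close>

lemma rotate: "line_cover n (\<lambda>y z. \<beta> z y) (\<lambda>x z. \<gamma> z x) \<alpha> R"
  using n_pos ind layers_x layers_y layers_z lines avg_swap[of n \<beta>] avg_swap[of n \<gamma>]
  by unfold_locales
    ((use cover in blast) | (auto simp: max.commute add.commute add.left_commute))+

text \<open>The minimal weight is written \<open>5/3 * \<tau>\<close> because a weight is at most
  5/3 of the larger density, so that every layer has larger density at least \<tau>. The counts over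
  U and V determined by layer \<open>z0\<close> are then fed into
  \<open>rook_density_inequality\<close>.\<close>

lemma density_bound_at_minimal_layer:
  assumes min_x: "\<And>x. x < n \<Longrightarrow> 5/3 * \<tau> \<le> layer_weight (avg n (\<lambda>z. \<beta> x z)) (avg n (\<lambda>y. \<gamma> x y))"
    and min_y: "\<And>y. y < n \<Longrightarrow> 5/3 * \<tau> \<le> layer_weight (avg n (\<lambda>z. \<alpha> y z)) (avg n (\<lambda>x. \<gamma> x y))"
    and min_z: "\<And>z. z < n \<Longrightarrow> 5/3 * \<tau> \<le> layer_weight (avg n (\<lambda>y. \<alpha> y z)) (avg n (\<lambda>x. \<beta> x z))"
    and z0: "z0 < n"
    and att: "layer_weight (avg n (\<lambda>y. \<alpha> y z0)) (avg n (\<lambda>x. \<beta> x z0)) = 5/3 * \<tau>"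
    and le: "avg n (\<lambda>x. \<beta> x z0) \<le> avg n (\<lambda>y. \<alpha> y z0)"
  shows "573/1000 \<le> R"
proof -
  have i0: "0 \<le> \<alpha> i j" "0 \<le> \<beta> i j" "0 \<le> \<gamma> i j" "\<alpha> i j \<le> 1" "\<beta> i j \<le> 1" "\<gamma> i j \<le> 1" for i j
    using ind[of i j] by auto
  define A B C C' where "A y = avg n (\<lambda>z. \<alpha> y z)" and "B x = avg n (\<lambda>z. \<beta> x z)"
    and "C x = avg n (\<lambda>y. \<gamma> x y)" and "C' y = avg n (\<lambda>x. \<gamma> x y)" for x y
  define A' B' where "A' z = avg n (\<lambda>y. \<alpha> y z)" and "B' z = avg n (\<lambda>x. \<beta> x z)" for z
  define P Q where "P y = \<alpha> y z0" and "Q x = \<beta> x z0" for x y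
  \<comment> \<open>\<open>P\<close> and \<open>Q\<close> indicate the complements of \<open>V\<close> and \<open>U\<close>.\<close>
  define p q where "p = avg n P" and "q = avg n Q"
  have P: "P y = 0 \<or> P y = 1" and Q: "Q x = 0 \<or> Q x = 1" for x y
    using ind by (auto simp: P_def Q_def)
  have P0: "0 \<le> P y" "0 \<le> 1 - P y" and Q0: "0 \<le> Q x" "0 \<le> 1 - Q x" for x y
    using P[of y] Q[of x] by auto
  define d1 where "d1 = avg n (\<lambda>x. avg n (\<lambda>y. (1 - Q x) * P y * \<gamma> x y))"
  define d2 where "d2 = avg n (\<lambda>x. avg n (\<lambda>y. Q x * (1 - P y) * \<gamma> x y))"
  define a where "a = avg n (\<lambda>x. (1 - Q x) * B x)"
  define b where "b = avg n (\<lambda>x. Q x * B x)"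
  define a' where "a' = avg n (\<lambda>y. (1 - P y) * A y)"
  define b' where "b' = avg n (\<lambda>y. P y * A y)"
  have d: "0 \<le> d1" "0 \<le> d2" unfolding d1_def d2_def
    using P0 Q0 i0 by (auto intro!: avg_nonneg mult_nonneg_nonneg)
  have cq: "avg n (\<lambda>x. 1 - Q x) = 1 - q" and cp: "avg n (\<lambda>y. 1 - P y) = 1 - p"
    by (simp_all add: avg_diff avg_const[OF n_pos] p_def q_def)
  have q0: "0 \<le> q" unfolding q_def using Q0 by (intro avg_nonneg)
  have qp: "q \<le> p" using le by (simp add: p_def q_def P_def[abs_def] Q_def[abs_def])
  have t: "3 * p + 2 * q = 5 * \<tau>"
    using att qp by (simp add: p_def q_def P_def[abs_def] Q_def[abs_def] layer_weight_def)
  \<comment> \<open>A point of U \<times> V at height \<open>z0\<close> is on no covered line of the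
    layer, so its perpendicular line is covered.\<close>
  have corner: "(1 - Q x) * (1 - P y) * \<gamma> x y = (1 - Q x) * (1 - P y)" if "x < n" "y < n" for x y
    using cover[OF that z0] by (auto simp: P_def Q_def)
  have w: "layer_weight s t = (max s t + 2 * (s + t)) / 3" for s t
    by (simp add: layer_weight_def max_def min_def)
  have wm: "\<tau> \<le> max s t" if "5/3 * \<tau> \<le> layer_weight s t" for s t
    using that unfolding layer_weight_def by (auto simp: max_def min_def split: if_splits)
  \<comment> \<open>Summed over the three directions, the maxima contribute at most
    \<open>3 * R\<close>; each family of lines occurs in two directions with factor 2, which gives
    at most \<open>4 * (2 * R)\<close>.\<close>
  have tR: "15 * \<tau> \<le> 11 * R"
  proof -
    have "avg n (\<lambda>x. 5 * \<tau>) \<le> avg n (\<lambda>x. max (B x) (C x) + (2 * B x + 2 * C x))"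
      using min_x by (intro avg_mono) (force simp: w B_def C_def)
    moreover have "avg n (\<lambda>y. 5 * \<tau>) \<le> avg n (\<lambda>y. max (A y) (C' y) + (2 * A y + 2 * C' y))"
      using min_y by (intro avg_mono) (force simp: w A_def C'_def)
    moreover have "avg n (\<lambda>z. 5 * \<tau>) \<le> avg n (\<lambda>z. max (A' z) (B' z) + (2 * A' z + 2 * B' z))"
      using min_z by (intro avg_mono) (force simp: w A'_def B'_def)
    moreover have "avg n A' = avg n A" "avg n B' = avg n B" "avg n C' = avg n C"
      unfolding A_def A'_def B_def B'_def C_def C'_def using avg_swap by metis+
    ultimately show ?thesis
      using layers_x layers_y layers_z lines
      unfolding avg_add avg_mult_left avg_const[OF n_pos]
        A_def[symmetric] B_def[symmetric] C_def[symmetric] A'_def[symmetric] B'_def[symmetric] C'_def[symmetric]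
      by linarith
  qed
  have UC: "(1-p)*(1-q) + d1 \<le> avg n (\<lambda>x. (1 - Q x) * C x)"
  proof -
    have "(1-p)*(1-q) + d1
        = avg n (\<lambda>x. avg n (\<lambda>y. (1 - Q x) * (1 - P y) + (1 - Q x) * P y * \<gamma> x y))"
      by (simp add: avg_add avg_mult_left avg_mult_right cp cq d1_def mult.commute)
    also have "\<dots> = avg n (\<lambda>x. avg n (\<lambda>y. (1 - Q x) * \<gamma> x y))"
      using corner by (intro avg_cong) (force simp: algebra_simps)
    finally show ?thesis by (simp add: avg_mult_left C_def)
  qed
  have VC: "(1-p)*(1-q) + d2 \<le> avg n (\<lambda>y. (1 - P y) * C' y)"
  proof -
    have "(1-p)*(1-q) + d2
        = avg n (\<lambda>x. avg n (\<lambda>y. (1 - Q x) * (1 - P y) + Q x * (1 - P y) * \<gamma> x y))"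
      by (simp add: avg_add avg_mult_left avg_mult_right cp cq d2_def mult.commute)
    also have "\<dots> = avg n (\<lambda>x. avg n (\<lambda>y. (1 - P y) * \<gamma> x y))"
      using corner by (intro avg_cong) (force simp: algebra_simps)
    finally show ?thesis using avg_swap[of n "\<lambda>x y. (1 - P y) * \<gamma> x y"] by (simp add: avg_mult_left C'_def)
  qed
  \<comment> \<open>The maximum is bounded below by \<open>C\<close> over U and by \<open>f\<close>
    over the complement. Constant \<open>f = \<tau>\<close> gives \<open>B1\<close>, and
    \<open>f = B\<close> gives \<open>B2\<close>.\<close>
  have B: "(1-p)*(1-q) + d1 + avg n (\<lambda>x. Q x * f x) \<le> R" 
    if "\<And>x. x < n \<Longrightarrow> f x \<le> max (B x) (C x)" for f
  proof -
    have "avg n (\<lambda>x. (1 - Q x) * C x + Q x * f x) \<le> avg n (\<lambda>x. max (B x) (C x))"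
    proof (rule avg_mono)
      fix x assume "x < n"
      thus "(1 - Q x) * C x + Q x * f x \<le> max (B x) (C x)" using Q[of x] that[of x] by auto
    qed
    thus ?thesis using UC layers_x by (simp add: avg_add B_def C_def)
  qed
  have C: "(1-p)*(1-q) + d2 + avg n (\<lambda>y. P y * f y) \<le> R" 
    if "\<And>y. y < n \<Longrightarrow> f y \<le> max (A y) (C' y)" for f
  proof -
    have "avg n (\<lambda>y. (1 - P y) * C' y + P y * f y) \<le> avg n (\<lambda>y. max (A y) (C' y))"
    proof (rule avg_mono)
      fix y assume "y < n"
      thus "(1 - P y) * C' y + P y * f y \<le> max (A y) (C' y)" using P[of y] that[of y] by auto
    qed
    thus ?thesis using VC layers_y by (simp add: avg_add A_def C'_def)
  qed
  have ab: "a + b = avg n B" "a' + b' = avg n A"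
    unfolding a_def b_def a'_def b'_def avg_add[symmetric] by (simp_all add: algebra_simps)
  \<comment> \<open>The covering condition is averaged along the perpendicular line over
    \<open>(x, y)\<close>. Weighting by the indicators of the two off-diagonal blocks then gives
    \<open>V1\<close> and \<open>V2\<close>.\<close>
  have cov: "1 \<le> \<gamma> x y + B x + A y" if "x < n" "y < n" for x y
  proof -
    have "avg n (\<lambda>z. 1) \<le> avg n (\<lambda>z. \<gamma> x y + \<beta> x z + \<alpha> y z)"
    proof (rule avg_mono)
      fix z assume "z < n"
      thus "1 \<le> \<gamma> x y + \<beta> x z + \<alpha> y z" using cover[OF that] i0 by (smt (verit))
    qed
    thus ?thesis by (simp add: avg_add avg_const[OF n_pos] A_def B_def)
  qed
  show ?thesis
  proof (rule rook_density_inequality[OF q0 qp t tR _ _ _ _ _ _ _ d])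
    show "(1-p)*(1-q) + d1 + q * \<tau> \<le> R"
      using B[of "\<lambda>x. \<tau>"] wm min_x by (simp add: avg_mult_right q_def B_def C_def)
    show "(1-p)*(1-q) + d1 + b \<le> R" using B[of B] by (simp add: b_def)
    show "(1-p)*(1-q) + d2 + p * \<tau> \<le> R"
      using C[of "\<lambda>x. \<tau>"] wm min_y by (simp add: avg_mult_right p_def A_def C'_def)
    show "(1-p)*(1-q) + d2 + b' \<le> R" using C[of A] by (simp add: b'_def)
    have "avg n (\<lambda>x. avg n (\<lambda>y. (1 - Q x) * P y)) \<le> avg n (\<lambda>x. avg n (\<lambda>y. (1 - Q x) * P y * \<gamma> x y
        + ((1 - Q x) * B x) * P y + (1 - Q x) * (P y * A y)))"
    proof (intro avg_mono)
      fix x y assume "x < n" "y < n"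
      from mult_left_mono[OF cov[OF this] mult_nonneg_nonneg[OF Q0(2) P0(1)]]
      show "(1 - Q x) * P y \<le> (1 - Q x) * P y * \<gamma> x y + ((1 - Q x) * B x) * P y + (1 - Q x) * (P y * A y)"
        by (simp add: algebra_simps)
    qed
    thus "p * (1-q) \<le> d1 + p * a + (1-q) * b'"
      by (simp add: avg_add avg_mult_left avg_mult_right cq d1_def a_def b'_def p_def[symmetric] mult.commute)
    have "avg n (\<lambda>x. avg n (\<lambda>y. Q x * (1 - P y))) \<le> avg n (\<lambda>x. avg n (\<lambda>y. Q x * (1 - P y) * \<gamma> x y
        + (Q x * B x) * (1 - P y) + Q x * ((1 - P y) * A y)))"
    proof (intro avg_mono)
      fix x y assume "x < n" "y < n"
      from mult_left_mono[OF cov[OF this] mult_nonneg_nonneg[OF Q0(1) P0(2)]]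
      show "Q x * (1 - P y) \<le> Q x * (1 - P y) * \<gamma> x y + (Q x * B x) * (1 - P y) + Q x * ((1 - P y) * A y)"
        by (simp add: algebra_simps)
    qed
    thus "q * (1-p) \<le> d2 + q * a' + (1-p) * b"
      by (simp add: avg_add avg_mult_left avg_mult_right cp d2_def b_def a'_def q_def[symmetric] mult.commute)
    \<comment> \<open>Perpendicular lines over the product of the two complements are
      dropped.\<close>
    have "(1-p)*(1-q) + d1 + d2 \<le> avg n C"
    proof -
      have "avg n (\<lambda>x. avg n (\<lambda>y. (1 - Q x) * (1 - P y) + (1 - Q x) * P y * \<gamma> x y + Q x * (1 - P y) * \<gamma> x y))
        \<le> avg n (\<lambda>x. avg n (\<lambda>y. \<gamma> x y))"
      proof (intro avg_mono)
        fix x y assume "x < n" "y < n"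
        thus "(1 - Q x) * (1 - P y) + (1 - Q x) * P y * \<gamma> x y + Q x * (1 - P y) * \<gamma> x y \<le> \<gamma> x y"
          using corner[of x y] P[of y] Q[of x] i0(3)[of x y] by auto
      qed
      thus ?thesis
        by (simp add: avg_add avg_mult_left avg_mult_right cp cq d1_def d2_def C_def[abs_def] mult.commute)
    qed
    thus "(1-p)*(1-q) + d1 + d2 + a + a' + b + b' \<le> 2 * R"
      using ab lines unfolding A_def[symmetric] B_def[symmetric] C_def[symmetric] by linarith
  qed
qed

text \<open>Exchanging the first two coordinates puts the two densities of the minimal layer in the
  required order.\<close>

lemma density_bound_if_minimal_z:
  assumes min_x: "\<And>x. x < n \<Longrightarrow> 5/3 * \<tau> \<le> layer_weight (avg n (\<lambda>z. \<beta> x z)) (avg n (\<lambda>y. \<gamma> x y))"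
    and min_y: "\<And>y. y < n \<Longrightarrow> 5/3 * \<tau> \<le> layer_weight (avg n (\<lambda>z. \<alpha> y z)) (avg n (\<lambda>x. \<gamma> x y))"
    and min_z: "\<And>z. z < n \<Longrightarrow> 5/3 * \<tau> \<le> layer_weight (avg n (\<lambda>y. \<alpha> y z)) (avg n (\<lambda>x. \<beta> x z))"
    and z0: "z0 < n"
    and att: "layer_weight (avg n (\<lambda>y. \<alpha> y z0)) (avg n (\<lambda>x. \<beta> x z0)) = 5/3 * \<tau>"
  shows "573/1000 \<le> R"
proof (cases "avg n (\<lambda>x. \<beta> x z0) \<le> avg n (\<lambda>y. \<alpha> y z0)")
  case True
  with assms show ?thesis by (rule density_bound_at_minimal_layer)
next
  case False
  show ?thesis
    by (rule line_cover.density_bound_at_minimal_layer[OF swap_xy, of \<tau> z0])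
      (use assms False in \<open>auto simp: layer_weight_commute\<close>)
qed

text \<open>Finitely many layers have a lightest one. One rotation turns first-coordinate layers
  into third-coordinate ones; two rotations do so for second-coordinate layers.\<close>

lemma density_bound: "573/1000 \<le> R"
proof -
  define X Y Z where "X x = layer_weight (avg n (\<lambda>z. \<beta> x z)) (avg n (\<lambda>y. \<gamma> x y))"
    and "Y y = layer_weight (avg n (\<lambda>z. \<alpha> y z)) (avg n (\<lambda>x. \<gamma> x y))"
    and "Z z = layer_weight (avg n (\<lambda>y. \<alpha> y z)) (avg n (\<lambda>x. \<beta> x z))" for x y z
  define W where "W = X ` {..<n} \<union> Y ` {..<n} \<union> Z ` {..<n}"
  have W: "finite W" "W \<noteq> {}" using n_pos by (auto simp: W_def)
  define \<tau> where "\<tau> = 3/5 * Min W"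
  have X: "5/3 * \<tau> \<le> X i" and Y: "5/3 * \<tau> \<le> Y i" and Z: "5/3 * \<tau> \<le> Z i" if "i < n" for i
    using W that by (auto simp: \<tau>_def W_def intro!: Min_le)
  have "Min W \<in> W" using W by (rule Min_in)
  hence "5/3 * \<tau> \<in> W" by (simp add: \<tau>_def)
  then consider x0 where "x0 < n" "X x0 = 5/3 * \<tau>" | y0 where "y0 < n" "Y y0 = 5/3 * \<tau>"
    | z0 where "z0 < n" "Z z0 = 5/3 * \<tau>"
    unfolding W_def by fastforce
  thus ?thesis
  proof cases
    case 1
    interpret r: line_cover n "\<lambda>y z. \<beta> z y" "\<lambda>x z. \<gamma> z x" \<alpha> R by (rule rotate)
    show ?thesis
      by (rule r.density_bound_if_minimal_z[of \<tau> x0])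
        (use X Y Z 1 in \<open>simp_all add: X_def Y_def Z_def layer_weight_commute\<close>)
  next
    case 2
    interpret r: line_cover n "\<lambda>y z. \<beta> z y" "\<lambda>x z. \<gamma> z x" \<alpha> R by (rule rotate)
    interpret rr: line_cover n "\<lambda>y z. \<gamma> y z" "\<lambda>x z. \<alpha> z x" "\<lambda>x y. \<beta> y x" R by (rule r.rotate)
    show ?thesis
      by (rule rr.density_bound_if_minimal_z[of \<tau> y0])
        (use X Y Z 2 in \<open>simp_all add: X_def Y_def Z_def layer_weight_commute\<close>)
  next
    case 3
    show ?thesis
      by (rule density_bound_if_minimal_z[of \<tau> z0])
        (use X Y Z 3 in \<open>simp_all add: X_def Y_def Z_def\<close>)
  qed
qed

end

section \<open>Rook coverings\<close>

lemma UNIV_3_eq: "(UNIV :: 3 set) = {0, 1, 2}"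
proof -
  have "card {0, 1, 2 :: 3} = 3" by simp
  hence "{0, 1, 2 :: 3} = UNIV" by (intro card_subset_eq) simp_all
  thus ?thesis by simp
qed

lemma forall_3: "(\<forall>i::3. P i) \<longleftrightarrow> P 0 \<and> P 1 \<and> P 2"
proof -
  have "(\<forall>i::3. P i) \<longleftrightarrow> (\<forall>i\<in>{0, 1, 2}. P i)" unfolding UNIV_3_eq[symmetric] by simp
  thus ?thesis by simp
qed

lemma finite_cube: "finite (cube n)"
proof -
  have "cube n = PiE (UNIV :: 3 set) (\<lambda>_. {..<n})"
    by (auto simp: cube_def PiE_def)
  thus ?thesis by (simp add: finite_PiE)
qed

lemma finite_rook_covering:
  assumes "rook_covering n R"
  shows "finite R"
proof -
  have "R \<subseteq> cube n \<times> UNIV"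
    using assms by (auto simp: rook_covering_def rooks_def)
  thus ?thesis by (rule finite_subset) (simp add: finite_cube)
qed

text \<open>Any \<open>i\<close> in the nonempty \<open>D\<close> absorbs the case
  \<open>Q = P\<close>, so being covered means lying on one of the rook's lines.\<close>

lemma covered_iff:
  assumes "D \<noteq> {}"
  shows "Q \<in> covered n (P, D) \<longleftrightarrow> Q \<in> cube n \<and> (\<exists>i\<in>D. \<forall>j. j \<noteq> i \<longrightarrow> Q j = P j)"
proof -
  have "(Q = P \<or> (\<exists>i\<in>D. {j. Q j \<noteq> P j} = {i})) \<longleftrightarrow> (\<exists>i\<in>D. \<forall>j. j \<noteq> i \<longrightarrow> Q j = P j)"
  proof safe
    show "\<exists>i\<in>D. \<forall>j. j \<noteq> i \<longrightarrow> P j = P j" using assms by auto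
  next
    fix i assume "i \<in> D" "{j. Q j \<noteq> P j} = {i}"
    thus "\<exists>i\<in>D. \<forall>j. j \<noteq> i \<longrightarrow> Q j = P j" by blast
  next
    fix i assume i: "i \<in> D" "\<forall>j. j \<noteq> i \<longrightarrow> Q j = P j" 
      and n: "\<not> (\<exists>i\<in>D. {j. Q j \<noteq> P j} = {i})"
    have "Q i = P i" using i n by blast
    thus "Q = P" using i by (metis ext)
  qed
  thus ?thesis by (simp add: covered_def)
qed

lemma rook_covering_iff:
  "rook_covering n R \<longleftrightarrow> R \<subseteq> rooks n \<and> inj_on fst R \<and>
    (\<forall>Q\<in>cube n. \<exists>(P, D)\<in>R. \<exists>i\<in>D. \<forall>j. j \<noteq> i \<longrightarrow> Q j = P j)"
proof -
  have *: "Q \<in> covered n r \<longleftrightarrow> (case r of (P, D) \<Rightarrow> \<exists>i\<in>D. \<forall>j. j \<noteq> i \<longrightarrow> Q j = P j)"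
    if r: "R \<subseteq> rooks n" "r \<in> R" and Q: "Q \<in> cube n" for r Q
  proof -
    obtain P D where "r = (P, D)" "card D = 2" using r by (auto simp: rooks_def)
    moreover from this have "D \<noteq> {}" by auto
    ultimately show ?thesis using Q by (simp add: covered_iff)
  qed
  show ?thesis unfolding rook_covering_def subset_eq[of "cube n"] UN_iff
    using * by (intro conj_cong refl ball_cong bex_cong) auto
qed

text \<open>Within the layer, coordinate \<open>j\<close> labels the parallel lines. A rook has a
  single \<open>j\<close>-coordinate and so accounts for at most one of them.\<close>

lemma card_layer_le:
  assumes "finite R" and S: "\<And>z. z < n \<Longrightarrow> S z \<Longrightarrow> \<exists>r\<in>R. fst r i = x \<and> fst r j = z"
  shows "avg n (\<lambda>z. of_bool (S z)) \<le> real (card {r\<in>R. fst r i = x}) / real n"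
proof -
  have "{..<n} \<inter> {z. S z} \<subseteq> (\<lambda>r. fst r j) ` {r\<in>R. fst r i = x}"
  proof
    fix z assume "z \<in> {..<n} \<inter> {z. S z}"
    with S obtain r where "r \<in> R" "fst r i = x" "fst r j = z" by blast
    thus "z \<in> (\<lambda>r. fst r j) ` {r\<in>R. fst r i = x}" by blast
  qed
  hence "card ({..<n} \<inter> {z. S z}) \<le> card {r\<in>R. fst r i = x}"
    by (rule surj_card_le[rotated]) (simp add: assms(1))
  thus ?thesis unfolding avg_def by (simp add: divide_right_mono)
qed

lemma avg_card_layer:
  assumes "finite R" and "\<And>r. r \<in> R \<Longrightarrow> fst r i < n"
  shows "avg n (\<lambda>x. real (card {r\<in>R. fst r i = x}) / real n) = real (card R) / real n ^ 2"
proof -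
  have "(\<lambda>r. fst r i) ` R \<subseteq> {..<n}" using assms(2) by blast
  hence "(\<Sum>x<n. \<Sum>r\<in>{r\<in>R. fst r i = x}. 1) = (\<Sum>r\<in>R. 1::real)"
    by (rule sum.group[OF assms(1) finite_lessThan])
  hence "(\<Sum>x<n. real (card {r\<in>R. fst r i = x})) = real (card R)" by simp
  thus ?thesis by (simp add: avg_def sum_divide_distrib[symmetric] power2_eq_square)
qed

lemma avg_lines_le:
  assumes "finite T" and S: "\<And>y z. y < n \<Longrightarrow> z < n \<Longrightarrow> S y z \<Longrightarrow> \<exists>r\<in>T. f r = y \<and> g r = z"
  shows "avg n (\<lambda>y. avg n (\<lambda>z. of_bool (S y z))) \<le> real (card T) / real n ^ 2"
proof -
  let ?L = "({..<n} \<times> {..<n}) \<inter> {s. S (fst s) (snd s)}"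
  have "?L \<subseteq> (\<lambda>r. (f r, g r)) ` T"
  proof
    fix s assume "s \<in> ?L"
    with S[of "fst s" "snd s"] obtain r where r: "r \<in> T" "f r = fst s" "g r = snd s" by auto
    hence "s = (f r, g r)" by simp
    thus "s \<in> (\<lambda>r. (f r, g r)) ` T" using r(1) by (rule image_eqI)
  qed
  hence card: "card ?L \<le> card T" by (rule surj_card_le[OF assms(1)])
  have "(\<Sum>y<n. \<Sum>z<n. of_bool (S y z)) = (\<Sum>s\<in>{..<n} \<times> {..<n}. of_bool (S (fst s) (snd s)))"
    by (simp only: sum.cartesian_product split_def)
  also have "\<dots> = real (card ?L)" by (rule sum_of_bool_eq) simp_all
  finally have eq: "(\<Sum>y<n. \<Sum>z<n. of_bool (S y z)) = real (card ?L)" .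
  have "avg n (\<lambda>y. avg n (\<lambda>z. of_bool (S y z))) = real (card ?L) / real n / real n"
    by (simp only: avg_def sum_divide_distrib[symmetric] eq)
  thus ?thesis using card by (simp add: divide_right_mono power2_eq_square)
qed

text \<open>The lines through rooks in their own directions form a \<open>line_cover\<close> with
  rook density \<open>card R / n^2\<close>, so \<open>density_bound\<close> applies.\<close>

lemma card_rook_covering_ge:
  assumes R: "rook_covering n R" and n: "0 < n"
  shows "573/1000 * real n ^ 2 \<le> real (card R)"
proof -
  have fin: "finite R" using R by (rule finite_rook_covering)
  have sub: "fst r i < n" "card (snd r) = 2" if "r \<in> R" for r i
    using R that by (auto simp: rook_covering_def rooks_def cube_def)
  define \<alpha> \<beta> \<gamma> where "\<alpha> y z \<longleftrightarrow> (\<exists>r\<in>R. 0 \<in> snd r \<and> fst r 1 = y \<and> fst r 2 = z)"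
    and "\<beta> x z \<longleftrightarrow> (\<exists>r\<in>R. 1 \<in> snd r \<and> fst r 0 = x \<and> fst r 2 = z)"
    and "\<gamma> x y \<longleftrightarrow> (\<exists>r\<in>R. 2 \<in> snd r \<and> fst r 0 = x \<and> fst r 1 = y)" for x y z
  have "line_cover n (\<lambda>y z. of_bool (\<alpha> y z)) (\<lambda>x z. of_bool (\<beta> x z)) (\<lambda>x y. of_bool (\<gamma> x y))
      (real (card R) / real n ^ 2)"
  proof
    fix x y z assume "x < n" "y < n" "z < n"
    define Q where "Q i = (if i = (0::3) then x else if i = 1 then y else z)" for i
    have Qs: "Q 0 = x" "Q 1 = y" "Q 2 = z" by (simp_all add: Q_def)
    have "Q \<in> cube n" using \<open>x < n\<close> \<open>y < n\<close> \<open>z < n\<close> by (auto simp: cube_def Q_def)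
    then obtain r i where r: "r \<in> R" "i \<in> snd r" "\<forall>j. j \<noteq> i \<longrightarrow> Q j = fst r j"
      using R unfolding rook_covering_iff by fastforce
    have "i \<in> {0, 1, 2}" unfolding UNIV_3_eq[symmetric] by simp
    then consider "i = 0" | "i = 1" | "i = 2" by blast
    hence "\<alpha> y z \<or> \<beta> x z \<or> \<gamma> x y"
    proof cases
      case 1
      hence "fst r 1 = y" "fst r 2 = z" using r(3) Qs by (simp_all add: forall_3)
      thus ?thesis using r 1 unfolding \<alpha>_def by blast
    next
      case 2
      hence "fst r 0 = x" "fst r 2 = z" using r(3) Qs by (simp_all add: forall_3)
      thus ?thesis using r 2 unfolding \<beta>_def by blast
    next
      case 3
      hence "fst r 0 = x" "fst r 1 = y" using r(3) Qs by (simp_all add: forall_3)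
      thus ?thesis using r 3 unfolding \<gamma>_def by blast
    qed
    thus "of_bool (\<alpha> y z) = (1::real) \<or> of_bool (\<beta> x z) = (1::real) \<or> of_bool (\<gamma> x y) = (1::real)" by auto
  next
    \<comment> \<open>The same rook count of a layer bounds both of its densities, hence their
      maximum.\<close>
    have a: "avg n (\<lambda>x. max (f x) (g x)) \<le> real (card R) / real n ^ 2"
      if "\<And>x. f x \<le> real (card {r\<in>R. fst r i = x}) / real n"
        "\<And>x. g x \<le> real (card {r\<in>R. fst r i = x}) / real n" for f g and i :: 3
    proof -
      have "avg n (\<lambda>x. max (f x) (g x)) \<le> avg n (\<lambda>x. real (card {r\<in>R. fst r i = x}) / real n)"
        using that by (intro avg_mono max.boundedI)
      thus ?thesis using avg_card_layer[OF fin, of i n] sub(1) by simp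
    qed
    show "avg n (\<lambda>x. max (avg n (\<lambda>z. of_bool (\<beta> x z))) (avg n (\<lambda>y. of_bool (\<gamma> x y)))) \<le> real (card R) / real n ^ 2"
      by (rule a[where i = 0, OF card_layer_le[OF fin, where j = 2] card_layer_le[OF fin, where j = 1]])
        (unfold \<beta>_def \<gamma>_def, blast+)
    show "avg n (\<lambda>y. max (avg n (\<lambda>z. of_bool (\<alpha> y z))) (avg n (\<lambda>x. of_bool (\<gamma> x y)))) \<le> real (card R) / real n ^ 2"
      by (rule a[where i = 1, OF card_layer_le[OF fin, where j = 2] card_layer_le[OF fin, where j = 0]])
        (unfold \<alpha>_def \<gamma>_def, blast+)
    show "avg n (\<lambda>z. max (avg n (\<lambda>y. of_bool (\<alpha> y z))) (avg n (\<lambda>x. of_bool (\<beta> x z)))) \<le> real (card R) / real n ^ 2"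
      by (rule a[where i = 2, OF card_layer_le[OF fin, where j = 1] card_layer_le[OF fin, where j = 0]])
        (unfold \<alpha>_def \<beta>_def, blast+)
    have "avg n (\<lambda>y. avg n (\<lambda>z. of_bool (\<alpha> y z))) \<le> real (card {r\<in>R. 0 \<in> snd r}) / real n ^ 2"
      by (rule avg_lines_le[where f = "\<lambda>r. fst r 1" and g = "\<lambda>r. fst r 2"]) (use fin in \<open>unfold \<alpha>_def, simp, blast\<close>)
    moreover have "avg n (\<lambda>x. avg n (\<lambda>z. of_bool (\<beta> x z))) \<le> real (card {r\<in>R. 1 \<in> snd r}) / real n ^ 2"
      by (rule avg_lines_le[where f = "\<lambda>r. fst r 0" and g = "\<lambda>r. fst r 2"]) (use fin in \<open>unfold \<beta>_def, simp, blast\<close>)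
    moreover have "avg n (\<lambda>x. avg n (\<lambda>y. of_bool (\<gamma> x y))) \<le> real (card {r\<in>R. 2 \<in> snd r}) / real n ^ 2"
      by (rule avg_lines_le[where f = "\<lambda>r. fst r 0" and g = "\<lambda>r. fst r 1"]) (use fin in \<open>unfold \<gamma>_def, simp, blast\<close>)
    \<comment> \<open>Double counting of pairs of a rook and one of its two directions.\<close>
    moreover have "card {r\<in>R. 0 \<in> snd r} + card {r\<in>R. 1 \<in> snd r} + card {r\<in>R. 2 \<in> snd r} = 2 * card R"
    proof -
      have "(\<Sum>i\<in>(UNIV::3 set). card {r\<in>R. i \<in> snd r}) = (\<Sum>i\<in>UNIV. \<Sum>r\<in>R. of_bool (i \<in> snd r))"
        using fin by (simp add: of_bool_def sum.If_cases Int_def)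
      also have "\<dots> = (\<Sum>r\<in>R. \<Sum>i\<in>UNIV. of_bool (i \<in> snd r))" by (rule sum.swap)
      also have "\<dots> = (\<Sum>r\<in>R. card (snd r))"
      proof (rule sum.cong[OF refl])
        fix r :: "(3 \<Rightarrow> nat) \<times> 3 set"
        have "(\<Sum>i\<in>UNIV. of_bool (i \<in> snd r)) = (\<Sum>i\<in>snd r. (1::nat))"
          by (rule sum.mono_neutral_cong_right) simp_all
        thus "(\<Sum>i\<in>UNIV. of_bool (i \<in> snd r)) = card (snd r)" by simp
      qed
      also have "\<dots> = 2 * card R" using sub(2) by simp
      finally show ?thesis unfolding UNIV_3_eq by simp
    qed
    moreover from this have "real (card {r\<in>R. 0 \<in> snd r}) / real n ^ 2
        + real (card {r\<in>R. 1 \<in> snd r}) / real n ^ 2 + real (card {r\<in>R. 2 \<in> snd r}) / real n ^ 2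
        = 2 * (real (card R) / real n ^ 2)"
      unfolding add_divide_distrib[symmetric] of_nat_add[symmetric] by simp
    ultimately show "avg n (\<lambda>y. avg n (\<lambda>z. of_bool (\<alpha> y z))) + avg n (\<lambda>x. avg n (\<lambda>z. of_bool (\<beta> x z)))
      + avg n (\<lambda>x. avg n (\<lambda>y. of_bool (\<gamma> x y))) \<le> 2 * (real (card R) / real n ^ 2)" by linarith
  qed (use n in simp_all)
  hence "573/1000 \<le> real (card R) / real n ^ 2" by (rule line_cover.density_bound)
  thus ?thesis using n by (simp add: field_simps)
qed

section \<open>Existence of the limit\<close>

lemma min_rooks_le: "rook_covering n R \<Longrightarrow> min_rooks n \<le> card R"
  unfolding min_rooks_def by (rule Least_le) blast

lemma min_rooks_attained:
  obtains R where "rook_covering n R" "card R = min_rooks n"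
proof -
  have "rook_covering n ((\<lambda>P. (P, {0, 1})) ` cube n)"
    unfolding rook_covering_iff by (auto simp: rooks_def inj_on_def)
  hence "\<exists>m R. rook_covering n R \<and> card R = m" by blast
  hence "\<exists>R. rook_covering n R \<and> card R = min_rooks n"
    unfolding min_rooks_def by (rule LeastI_ex)
  thus ?thesis using that by blast
qed

text \<open>Every point is blown up to a block of side \<open>m\<close>, and its rook is copied to
  the block's points with coordinate sum divisible by \<open>m\<close>. Each axis-parallel line of a
  block meets this Latin square.\<close>

lemma min_rooks_mult:
  assumes m: "0 < m"
  shows "min_rooks (m * k) \<le> m ^ 2 * min_rooks k"
proof -
  obtain R where R: "rook_covering k R" and card_R: "card R = min_rooks k"
    by (rule min_rooks_attained)
  have fin: "finite R" using R by (rule finite_rook_covering)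
  define R' where "R' = {(Q, D). ((\<lambda>i. Q i div m), D) \<in> R \<and> m dvd (\<Sum>i\<in>UNIV. Q i)}"
  have less: "a div m < k \<longleftrightarrow> a < m * k" for a
    using m by (simp add: div_less_iff_less_mult mult.commute)
  have "rook_covering (m * k) R'"
    unfolding rook_covering_iff
  proof (intro conjI ballI)
    show "R' \<subseteq> rooks (m * k)"
      using R by (force simp: R'_def rook_covering_def rooks_def cube_def less)
    have "inj_on fst R" using R by (simp add: rook_covering_def)
    thus "inj_on fst R'" unfolding R'_def inj_on_def by force
    fix Q assume "Q \<in> cube (m * k)"
    hence "(\<lambda>i. Q i div m) \<in> cube k" by (simp add: cube_def less)
    then obtain P D i where r: "(P, D) \<in> R" "i \<in> D" "\<forall>j. j \<noteq> i \<longrightarrow> Q j div m = P j"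
      using R unfolding rook_covering_iff by fastforce
    define s where "s = (\<Sum>j\<in>UNIV - {i}. Q j)"
    \<comment> \<open>The factor \<open>m - 1\<close> stands for -1 modulo \<open>m\<close>, so
      \<open>c\<close> is the residue that makes the coordinate sum divisible by
      \<open>m\<close>.\<close>
    define c where "c = ((m - 1) * s) mod m"
    have "(c + s) mod m = ((m - 1) * s + s) mod m" unfolding c_def by (rule mod_add_left_eq)
    also have "(m - 1) * s + s = m * s" using m by (cases m) auto
    finally have "m dvd c + s" by (simp add: dvd_eq_mod_eq_0)
    hence dvd: "m dvd (m * P i + c) + s" by (simp add: add.assoc)
    have c: "c < m" using m by (simp add: c_def)
    define Q' where "Q' = Q(i := m * P i + c)"
    have "(\<Sum>j\<in>UNIV. Q' j) = Q' i + (\<Sum>j\<in>UNIV - {i}. Q' j)" by (simp add: sum.remove)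
    also have "(\<Sum>j\<in>UNIV - {i}. Q' j) = s" unfolding s_def by (rule sum.cong) (auto simp: Q'_def)
    finally have "m dvd (\<Sum>j\<in>UNIV. Q' j)" using dvd by (simp add: Q'_def)
    moreover have "(\<lambda>j. Q' j div m) = P" using r(3) c m by (auto simp: Q'_def)
    ultimately have "(Q', D) \<in> R'" using r(1) by (simp add: R'_def)
    moreover have "\<exists>i\<in>D. \<forall>j. j \<noteq> i \<longrightarrow> Q j = Q' j" using r(2) by (auto simp: Q'_def)
    ultimately show "\<exists>(P, D)\<in>R'. \<exists>i\<in>D. \<forall>j. j \<noteq> i \<longrightarrow> Q j = P j" by blast
  qed
  hence "min_rooks (m * k) \<le> card R'" by (rule min_rooks_le)
  also have "\<dots> \<le> card (R \<times> {..<m} \<times> {..<m})"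
  proof (rule card_inj_on_le)
    \<comment> \<open>The block and two residues determine a point of the Latin square, since
      divisibility forces the third residue.\<close>
    define g where "g r = (((\<lambda>i. fst r i div m), snd r), fst r 0 mod m, fst r 1 mod m)"
      for r :: "(3 \<Rightarrow> nat) \<times> 3 set"
    show "g ` R' \<subseteq> R \<times> {..<m} \<times> {..<m}" using m by (auto simp: g_def R'_def)
    show "finite (R \<times> {..<m} \<times> {..<m})" using fin by simp
    show "inj_on g R'"
    proof (rule inj_onI)
      fix r r' assume r: "r \<in> R'" "r' \<in> R'" "g r = g r'"
      obtain Q D Q' D' where rr: "r = (Q, D)" "r' = (Q', D')" by (metis surj_pair)
      have D: "D = D'" and d: "Q i div m = Q' i div m" for i
        using r(3) by (auto simp: g_def rr dest: fun_cong)
      have m01: "Q 0 mod m = Q' 0 mod m" "Q 1 mod m = Q' 1 mod m"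
        using r(3) by (auto simp: g_def rr)
      have Q01: "Q 0 = Q' 0" "Q 1 = Q' 1"
        using m01 d by (metis div_mult_mod_eq)+
      have "m dvd Q 0 + Q 1 + Q 2" "m dvd Q' 0 + Q' 1 + Q' 2"
        using r(1,2) unfolding R'_def rr UNIV_3_eq by (simp_all add: add.assoc)
      hence "(Q 0 + Q 1 + Q 2) mod m = (Q 0 + Q 1 + Q' 2) mod m"
        unfolding Q01 by (simp add: dvd_eq_mod_eq_0)
      hence "Q 2 mod m = Q' 2 mod m"
        by (simp add: add.assoc nat_mod_eq_iff)
      hence "Q 2 = Q' 2" using d by (metis div_mult_mod_eq)
      hence "\<forall>i. Q i = Q' i" using Q01 by (simp add: forall_3)
      thus "r = r'" using D rr by auto
    qed
  qed
  also have "\<dots> = m ^ 2 * min_rooks k" by (simp add: card_cartesian_product card_R power2_eq_square)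
  finally show ?thesis .
qed

text \<open>The new points fill three faces. A diagonal of rooks covers a face, because one of the
  directions 0 and 1 runs inside it and changes just one of the two coordinates equal on the
  diagonal.\<close>

lemma min_rooks_Suc: "min_rooks (Suc n) \<le> min_rooks n + 3 * Suc n"
proof -
  obtain R where R: "rook_covering n R" and card_R: "card R = min_rooks n"
    by (rule min_rooks_attained)
  define pt where "pt x y z = (\<lambda>i::3. if i = 0 then x else if i = 1 then y else z)" for x y z :: nat
  have pt: "pt x y z 0 = x" "pt x y z 1 = y" "pt x y z 2 = z" for x y z
    by (simp_all add: pt_def)
  \<comment> \<open>The range includes \<open>n\<close> because each face contains its outer edges;
    the three diagonals share the corner \<open>pt n n n\<close>.\<close>
  define N where "N = (\<lambda>t. pt n t t) ` {..n} \<union> (\<lambda>t. pt t n t) ` {..n} \<union> (\<lambda>t. pt t t n) ` {..n}"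
  let ?S = "(\<lambda>P. (P, {0, 1 :: 3})) ` N"
  have pt_cube: "pt x y z \<in> cube k \<longleftrightarrow> x < k \<and> y < k \<and> z < k" for x y z k
    unfolding cube_def mem_Collect_eq forall_3 pt by (rule refl)
  have "\<forall>P\<in>N. P \<in> cube (Suc n) \<and> P \<notin> cube n"
    unfolding N_def ball_Un ball_simps(9) pt_cube by simp
  hence N: "N \<subseteq> cube (Suc n)" "N \<inter> cube n = {}" by blast+
  have "rook_covering (Suc n) (R \<union> ?S)"
    unfolding rook_covering_iff
  proof (intro conjI ballI)
    have "cube n \<subseteq> cube (Suc n)" by (auto simp: cube_def less_Suc_eq)
    thus "R \<union> ?S \<subseteq> rooks (Suc n)"
      using R N(1) by (auto simp: rook_covering_def rooks_def)
    have "fst ` R \<subseteq> cube n" using R by (auto simp: rook_covering_def rooks_def)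
    moreover have "inj_on fst ?S" by (auto simp: inj_on_def)
    moreover have "inj_on fst R" using R by (simp add: rook_covering_def)
    ultimately show "inj_on fst (R \<union> ?S)" using N(2) unfolding inj_on_Un by fastforce
    fix Q assume Q: "Q \<in> cube (Suc n)"
    show "\<exists>(P, D)\<in>R \<union> ?S. \<exists>i\<in>D. \<forall>j. j \<noteq> i \<longrightarrow> Q j = P j"
    proof (cases "Q \<in> cube n")
      case True
      thus ?thesis using R unfolding rook_covering_iff by blast
    next
      case False
      have le: "Q i \<le> n" for i using Q by (simp add: cube_def less_Suc_eq_le)
      have new: "\<exists>(P, D)\<in>R \<union> ?S. \<exists>i\<in>D. \<forall>j. j \<noteq> i \<longrightarrow> Q j = P j"
        if "P \<in> N" "i \<in> {0, 1}" "\<forall>j. j \<noteq> i \<longrightarrow> Q j = P j" for P i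
        using that by (intro bexI[of _ "(P, {0, 1})"]) auto
      from False have "\<not> (Q 0 < n \<and> Q 1 < n \<and> Q 2 < n)" by (simp add: cube_def forall_3)
      hence "Q 0 = n \<or> Q 1 = n \<or> Q 2 = n" using le by (meson le_neq_implies_less)
      then consider "Q 0 = n" | "Q 1 = n" | "Q 2 = n" by blast
      thus ?thesis
      proof cases
        case 1
        have "pt n (Q 2) (Q 2) \<in> N" using le by (auto simp: N_def)
        thus ?thesis by (rule new[where i = 1]) (use 1 in \<open>simp_all add: forall_3 pt\<close>)
      next
        case 2
        have "pt (Q 2) n (Q 2) \<in> N" using le by (auto simp: N_def)
        thus ?thesis by (rule new[where i = 0]) (use 2 in \<open>simp_all add: forall_3 pt\<close>)
      next
        case 3
        have "pt (Q 1) (Q 1) n \<in> N" using le by (auto simp: N_def)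
        thus ?thesis by (rule new[where i = 0]) (use 3 in \<open>simp_all add: forall_3 pt\<close>)
      qed
    qed
  qed
  hence "min_rooks (Suc n) \<le> card (R \<union> ?S)" by (rule min_rooks_le)
  also have "\<dots> \<le> card R + card ?S" by (rule card_Un_le)
  also have "card ?S \<le> card N" by (rule card_image_le) (simp add: N_def)
  also have "card N \<le> Suc n + Suc n + Suc n"
    unfolding N_def
    by (intro order_trans[OF card_Un_le] add_mono order_trans[OF card_image_le]) simp_all
  finally show ?thesis by (simp add: card_R)
qed

lemma min_rooks_add: "min_rooks (n + r) \<le> min_rooks n + 3 * r * (n + r)"
proof (induction r)
  case (Suc r)
  have "min_rooks (n + Suc r) \<le> min_rooks (n + r) + 3 * (n + Suc r)"
    using min_rooks_Suc[of "n + r"] by simp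
  also have "\<dots> \<le> min_rooks n + 3 * r * (n + Suc r) + 3 * (n + Suc r)"
    using Suc.IH by (simp add: algebra_simps)
  finally show ?case by (simp add: algebra_simps)
qed simp

text \<open>A covering of side \<open>k\<close> is blown up by \<open>n div k\<close>; the fewer
  than \<open>k\<close> missing layers cost at most \<open>3 * n\<close> rooks each.\<close>

lemma rook_ratio_le:
  assumes k: "1 \<le> k" and kn: "k \<le> n"
  shows "real (min_rooks n) / real n ^ 2 \<le> real (min_rooks k) / real k ^ 2 + 3 * real k / real n"
proof -
  define m where "m = n div k"
  have m: "0 < m" using k kn by (simp add: m_def div_greater_zero_iff)
  have mk: "m * k \<le> n" by (simp add: m_def)
  have n0: "0 < n" using k kn by simp
  have "min_rooks n = min_rooks (m * k + n mod k)" by (simp add: m_def)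
  also have "\<dots> \<le> min_rooks (m * k) + 3 * (n mod k) * (m * k + n mod k)" by (rule min_rooks_add)
  also have "m * k + n mod k = n" by (simp add: m_def)
  also have "min_rooks (m * k) + 3 * (n mod k) * n \<le> m ^ 2 * min_rooks k + 3 * k * n"
    using k by (intro add_mono min_rooks_mult m mult_mono) auto
  finally have "real (min_rooks n) \<le> real (m ^ 2 * min_rooks k + 3 * k * n)" by (rule of_nat_mono)
  hence "real (min_rooks n) / real n ^ 2 \<le> (real m ^ 2 * real (min_rooks k) + 3 * real k * real n) / real n ^ 2"
    by (intro divide_right_mono) simp_all
  also have "\<dots> = (real m / real n) ^ 2 * real (min_rooks k) + 3 * real k / real n"
    using n0 by (simp add: field_simps power2_eq_square)
  also have "(real m / real n) ^ 2 * real (min_rooks k) \<le> (1 / real k) ^ 2 * real (min_rooks k)"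
  proof (intro mult_right_mono power_mono)
    have "real m * real k \<le> real n" using mk by (metis of_nat_le_iff of_nat_mult)
    thus "real m / real n \<le> 1 / real k" using n0 k by (simp add: field_simps)
  qed simp_all
  finally show ?thesis by (simp add: power_divide)
qed

text \<open>The limit is the infimum over positive indices: for fixed \<open>k\<close> the error
  term vanishes, so \<open>u\<close> eventually stays below any number exceeding
  \<open>u k\<close>.\<close>

lemma convergent_if_almost_decreasing:
  fixes u :: "nat \<Rightarrow> real"
  assumes nonneg: "\<And>n. 0 \<le> u n"
    and le: "\<And>k n. 1 \<le> k \<Longrightarrow> k \<le> n \<Longrightarrow> u n \<le> u k + c * real k / real n"
  shows "convergent u"
proof -
  define L where "L = Inf (u ` {1..})"
  have bdd: "bdd_below (u ` {1..})" using nonneg by (intro bdd_belowI2)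
  have "u \<longlonglongrightarrow> L"
  proof (rule order_tendstoI)
    fix a assume "a < L"
    have "L \<le> u n" if "1 \<le> n" for n
      unfolding L_def using bdd that by (intro cInf_lower) auto
    thus "\<forall>\<^sub>F n in sequentially. a < u n"
      using \<open>a < L\<close> eventually_ge_at_top[of 1] by (metis (mono_tags, lifting) eventually_mono less_le_trans)
  next
    fix a assume "L < a"
    then obtain k where k: "1 \<le> k" "u k < a"
      unfolding L_def using cInf_lessD[of "u ` {1..}" a] by auto
    have "(\<lambda>n. u k + c * real k / real n) \<longlonglongrightarrow> u k + 0"
      by (intro tendsto_add tendsto_const lim_const_over_n)
    hence "\<forall>\<^sub>F n in sequentially. u k + c * real k / real n < a"
      using k(2) by (intro order_tendstoD(2)) simp_all
    thus "\<forall>\<^sub>F n in sequentially. u n < a"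
      using eventually_ge_at_top[of k]
      by eventually_elim (use le[OF k(1)] in \<open>force intro: le_less_trans\<close>)
  qed
  thus ?thesis by (rule convergentI)
qed

theorem theorem14:
  "(9 - 3 * sqrt 5) / 4 \<le> rook_density"
proof -
  let ?u = "\<lambda>n. real (min_rooks n) / real n ^ 2"
  \<comment> \<open>Convergence is what identifies the value of \<open>lim\<close> with an actual
    limit.\<close>
  have "convergent ?u"
    by (rule convergent_if_almost_decreasing[where c = 3]) (simp_all add: rook_ratio_le)
  hence "?u \<longlonglongrightarrow> rook_density" unfolding rook_density_def by (rule convergent_LIMSEQ_iff[THEN iffD1])
  moreover have "573/1000 \<le> ?u n" if "1 \<le> n" for n
  proof -
    obtain R where "rook_covering n R" "card R = min_rooks n" by (rule min_rooks_attained)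
    thus ?thesis using card_rook_covering_ge[of n R] that by (simp add: field_simps)
  qed
  ultimately have "573/1000 \<le> rook_density" by (intro LIMSEQ_le_const) blast+
  \<comment> \<open>Rounding \<open>sqrt 5\<close> down to 2.236 turns the claimed bound into
    exactly 573/1000.\<close>
  moreover have "2236/1000 \<le> sqrt 5" by (rule real_le_rsqrt) (simp add: power2_eq_square)
  ultimately show ?thesis by simp
qed

end
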